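(* Let $X, X_1, X_2, \ldots$ be i.i.d. real random variables with common law $P$ on $\mathbb{R}$. Suppose the functions $F:\mathbb{R}\to\mathbb{R}$ and $U:\mathbb{R}\to\mathbb{R}$ are such that $\mu := E[F(X)]$ and $\nu := E[U(X)]$ are both finite, and that $m(\beta) := \operatorname{ess\,sup}[F(X)-\beta U(X)] < \infty$ for all $\beta>0$. Let $S_n := \sum_{i=1}^n F(X_i)$ and $T_n := \sum_{i=1}^n U(X_i)$. Then for all $\varepsilon,u>0$: (i) $\Pr\{S_n-n\mu>n\varepsilon,\ T_n-n\nu<nu\}\le \exp\{-nH(E\|P)\}$ for all $n\ge1$, where $$H(E\|P):=\inf\{H(Q\|P): Q\in E\},$$ and $E$ is the set of all probability measures $Q$ on $\mathbb{R}$ such that $\int F\,dQ-\mu>\varepsilon$ and $\int U\,dQ-\nu<u$. (ii) $\Pr\{S_n-n\mu>n\varepsilon,\ T_n-n\nu<nu\}\le \exp\{-n\Lambda_+^*(\varepsilon,u)\}$ for all $n\ge1$, where $$\Lambda_+^*(\varepsilon,u):=\sup_{\theta_1,\theta_2\ge0}\{\theta_1(\mu+\varepsilon)-\theta_2(\nu+u)-\Lambda_+(\theta_1,\theta_2)\},$$ with $\Lambda_+(\theta_1,\theta_2):=\log E[\exp\{\theta_1F(X)-\theta_2U(X)\}]$, $\theta_1,\theta_2\ge0$. (iii) The rate function $\Lambda_+^*(\varepsilon,u)$ is strictly positive.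
   Context: Functions are Borel measurable. The relative entropy between probability measures $Q$ and $P$ on the same space is $H(Q\|P) := \int dQ\,\log\frac{dQ}{dP}$ when the density $\frac{dQ}{dP}$ exists, and $H(Q\|P):=\infty$ otherwise. The essential supremum is with respect to the law of $X$. Integral conditions defining $E$ are understood to require that the integrals be well defined (in the extended reals). $\Lambda_+$ takes values in $(-\infty,\infty]$ and $\Lambda_+^*$ may equal $+\infty$. Conventions: $e^{-\infty}=0$, and the infimum over the empty set is $+\infty$. *)

theory Defs
  imports "HOL-Probability.Probability"
begin

definition pos_part_integral :: "'a measure \<Rightarrow> ('a \<Rightarrow> real) \<Rightarrow> ereal" where
  "pos_part_integral Q f = enn2ereal (\<integral>\<^sup>+x. ennreal (max 0 (f x)) \<partial>Q)"

definition neg_part_integral :: "'a measure \<Rightarrow> ('a \<Rightarrow> real) \<Rightarrow> ereal" where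
  "neg_part_integral Q f = enn2ereal (\<integral>\<^sup>+x. ennreal (max 0 (- f x)) \<partial>Q)"

definition ext_integral_defined :: "'a measure \<Rightarrow> ('a \<Rightarrow> real) \<Rightarrow> bool" where
  "ext_integral_defined Q f \<longleftrightarrow>
     f \<in> borel_measurable Q \<and> (pos_part_integral Q f < \<infinity> \<or> neg_part_integral Q f < \<infinity>)"

(* Meaningful only under ext_integral_defined: in ereal, \<infinity> - \<infinity> = \<infinity>. *)
definition ext_integral :: "'a measure \<Rightarrow> ('a \<Rightarrow> real) \<Rightarrow> ereal" where
  "ext_integral Q f = pos_part_integral Q f - neg_part_integral Q f"

(* The extended-valued version of the library's real-valued KL_divergence, which is 0 when the
   log density is not integrable. The library puts the reference measure first:
   entropy_density (exp 1) P Q is log (dQ/dP). For probability measures its negative part is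
   Q-integrable, so the integral below is always well defined. *)
definition relative_entropy :: "'a measure \<Rightarrow> 'a measure \<Rightarrow> ereal" where
  "relative_entropy Q P =
     (if \<exists>f \<in> borel_measurable P. density P f = Q
      then ext_integral Q (entropy_density (exp 1) P Q)
      else \<infinity>)"

(* The infimum of the empty set is \<infinity> in ereal. *)
definition set_relative_entropy :: "'a measure set \<Rightarrow> 'a measure \<Rightarrow> ereal" where
  "set_relative_entropy E P = (INF Q \<in> E. relative_entropy Q P)"

definition constraint_set ::
  "(real \<Rightarrow> real) \<Rightarrow> (real \<Rightarrow> real) \<Rightarrow> real \<Rightarrow> real \<Rightarrow> real \<Rightarrow> real \<Rightarrow> real measure set" where
  "constraint_set F U \<mu> \<nu> \<epsilon> u =
     {Q. prob_space Q \<and> sets Q = sets borel \<and>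
         ext_integral_defined Q F \<and> ext_integral Q F - ereal \<mu> > ereal \<epsilon> \<and>
         ext_integral_defined Q U \<and> ext_integral Q U - ereal \<nu> < ereal u}"

definition ereal_exp :: "ereal \<Rightarrow> ereal" where
  "ereal_exp x = (case x of ereal r \<Rightarrow> ereal (exp r) | PInfty \<Rightarrow> \<infinity> | MInfty \<Rightarrow> 0)"

definition ennreal_log :: "ennreal \<Rightarrow> ereal" where
  "ennreal_log x =
     (if x = 0 then - \<infinity> else if x = \<infinity> then \<infinity> else ereal (ln (enn2real x)))"

definition Lambda_plus ::
  "'a measure \<Rightarrow> ('a \<Rightarrow> real) \<Rightarrow> (real \<Rightarrow> real) \<Rightarrow> (real \<Rightarrow> real) \<Rightarrow> real \<Rightarrow> real \<Rightarrow> ereal" where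
  "Lambda_plus M X F U \<theta>1 \<theta>2 =
     ennreal_log (\<integral>\<^sup>+\<omega>. ennreal (exp (\<theta>1 * F (X \<omega>) - \<theta>2 * U (X \<omega>))) \<partial>M)"

definition Lambda_plus_star ::
  "'a measure \<Rightarrow> ('a \<Rightarrow> real) \<Rightarrow> (real \<Rightarrow> real) \<Rightarrow> (real \<Rightarrow> real) \<Rightarrow> real \<Rightarrow> real \<Rightarrow> real \<Rightarrow> real \<Rightarrow> ereal" where
  "Lambda_plus_star M X F U \<mu> \<nu> \<epsilon> u =
     (SUP (\<theta>1, \<theta>2) \<in> {0..} \<times> {0..}.
        ereal (\<theta>1 * (\<mu> + \<epsilon>) - \<theta>2 * (\<nu> + u)) - Lambda_plus M X F U \<theta>1 \<theta>2)"

end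

theory Submission
  imports Defs
begin

text \<open>
  For (i), let \<open>A\<close> be the event in question, \<open>p\<close> its probability, and \<open>Q\<close> the average over \<open>i \<le> n\<close> of
  the laws of \<open>X\<^sub>i\<close> conditioned on \<open>A\<close>. Averaging the two inequalities that define \<open>A\<close> shows that
  \<open>Q\<close> lies in \<open>E\<close>. Its density \<open>h\<close> is bounded by \<open>1 / p\<close>, and Jensen's inequality applied to
  \<open>\<Prod>\<^sub>i h(X\<^sub>i)\<close>, which has mean \<open>1\<close> by independence, gives \<open>n H(Q\<parallel>P) \<le> - ln p\<close>. Part (ii) is
  Chernoff's bound. For (iii), on the ray \<open>\<theta>\<^sub>2 = \<beta> \<theta>\<^sub>1\<close> with \<open>\<beta> u < \<epsilon>\<close> the function
  \<open>F - \<beta> U\<close> is essentially bounded above and has mean below \<open>\<mu> + \<epsilon> - \<beta> (\<nu> + u)\<close>, so a small exponent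
  already makes the supremum positive.
\<close>

section \<open>Extended integrals, and the passage from rates to exponential bounds\<close>

lemma ext_integral_integrable:
  fixes f :: "'a \<Rightarrow> real"
  assumes "integrable Q f"
  shows "ext_integral_defined Q f" "ext_integral Q f = ereal (\<integral>x. f x \<partial>Q)"
proof -
  have pos: "integrable Q (\<lambda>x. max 0 (f x))" and neg: "integrable Q (\<lambda>x. max 0 (- f x))"
    using assms by auto
  have pos_eq: "pos_part_integral Q f = ereal (\<integral>x. max 0 (f x) \<partial>Q)"
    unfolding pos_part_integral_def using nn_integral_eq_integral[OF pos] by simp
  have neg_eq: "neg_part_integral Q f = ereal (\<integral>x. max 0 (- f x) \<partial>Q)"
    unfolding neg_part_integral_def using nn_integral_eq_integral[OF neg] by simp
  show "ext_integral_defined Q f"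
    using assms by (simp add: ext_integral_defined_def pos_eq)
  have "(\<integral>x. max 0 (f x) \<partial>Q) - (\<integral>x. max 0 (- f x) \<partial>Q) = (\<integral>x. max 0 (f x) - max 0 (- f x) \<partial>Q)"
    using pos neg by simp
  also have "\<dots> = (\<integral>x. f x \<partial>Q)"
    by (intro Bochner_Integration.integral_cong) auto
  finally show "ext_integral Q f = ereal (\<integral>x. f x \<partial>Q)"
    by (simp add: ext_integral_def pos_eq neg_eq)
qed

lemma ereal_exp_mono: "x \<le> y \<Longrightarrow> ereal_exp x \<le> ereal_exp y"
  by (cases x; cases y) (auto simp: ereal_exp_def)

lemma ereal_exp_nonneg: "0 \<le> ereal_exp x"
  by (cases x) (auto simp: ereal_exp_def)

text \<open>Common last step of (i) and (ii): the exponential bound is read as an upper bound on the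
  rate \<open>L\<close>. At \<open>p = 0\<close> the right-hand side is nonnegative whatever
  \<open>L\<close> is, so only events of positive probability need work; for these the bound on
  \<open>L\<close> is real and the logarithm is meaningful.\<close>

lemma le_ereal_exp_rate:
  fixes p :: real
  assumes "0 \<le> p" and "1 \<le> n" and "p > 0 \<Longrightarrow> L \<le> ereal (- ln p / real n)"
  shows "ereal p \<le> ereal_exp (- (ereal (real n) * L))"
proof (cases "p = 0")
  case True
  then show ?thesis using ereal_exp_nonneg by (simp flip: zero_ereal_def)
next
  case False
  with assms have "p > 0" by simp
  have "ereal (real n) * L \<le> ereal (real n) * ereal (- ln p / real n)"
    using assms(3)[OF \<open>p > 0\<close>] by (intro ereal_mult_left_mono) auto
  also have "\<dots> = - ereal (ln p)"
    using \<open>1 \<le> n\<close> by simp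
  finally have "ereal (ln p) \<le> - (ereal (real n) * L)"
    using ereal_minus_le_minus[of "- ereal (ln p)"] by simp
  from ereal_exp_mono[OF this] show ?thesis
    using \<open>p > 0\<close> by (simp add: ereal_exp_def)
qed

section \<open>Densities of conditioned laws\<close>

text \<open>Domination implies absolute continuity, so Radon-Nikodym supplies a density
  \<open>r\<close>. If \<open>r\<close> exceeded 1 on a non-null set \<open>C\<close>, integrating
  it there would give \<open>N\<close> more mass on \<open>C\<close> than \<open>M\<close> has;
  finiteness of \<open>M\<close> keeps this comparison strict.\<close>

lemma (in finite_measure) dominated_density:
  assumes sets: "sets N = sets M"
    and le: "\<And>B. B \<in> sets M \<Longrightarrow> emeasure N B \<le> emeasure M B"
  obtains g :: "'a \<Rightarrow> real" where "g \<in> borel_measurable M" "\<And>x. 0 \<le> g x" "\<And>x. g x \<le> 1"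
    "N = density M (\<lambda>x. ennreal (g x))"
proof -
  have "absolutely_continuous M N"
    using le unfolding absolutely_continuous_def null_sets_def by (fastforce simp: sets)
  then obtain r where r[measurable]: "r \<in> borel_measurable M" and N: "density M r = N"
    using Radon_Nikodym sets by metis
  have "AE x in M. r x \<le> 1"
  proof (rule ccontr)
    assume not_le: "\<not> (AE x in M. r x \<le> 1)"
    define C where "C = {x \<in> space M. r x > 1}"
    have [measurable]: "C \<in> sets M" unfolding C_def by measurable
    have "(\<integral>\<^sup>+x. indicator C x \<partial>M) < (\<integral>\<^sup>+x. r x * indicator C x \<partial>M)"
    proof (rule nn_integral_less)
      show "(\<integral>\<^sup>+x. indicator C x \<partial>M) \<noteq> \<infinity>" by simp
      show "AE x in M. indicator C x \<le> r x * indicator C x"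
        by (auto simp: C_def indicator_def)
      show "\<not> (AE x in M. r x * indicator C x \<le> indicator C x)"
      proof
        assume "AE x in M. r x * indicator C x \<le> indicator C x"
        moreover have "AE x in M. x \<in> space M" by simp
        ultimately have "AE x in M. r x \<le> 1"
          by eventually_elim (rule ccontr, auto simp: C_def not_le)
        with not_le show False by simp
      qed
    qed auto
    also have "\<dots> = emeasure N C" by (simp add: N[symmetric] emeasure_density)
    also have "\<dots> \<le> emeasure M C" by (rule le) simp
    finally show False by simp
  qed
  \<comment> \<open>Truncation at 1 changes \<open>r\<close> only on a null set, and yields a
    real-valued version whose bounds hold at every point.\<close>
  then have "AE x in M. r x = ennreal (enn2real (min 1 (r x)))"
    by eventually_elim (auto simp: min_absorb2 ennreal_enn2real_if top_unique)
  then have "N = density M (\<lambda>x. ennreal (enn2real (min 1 (r x))))"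
    unfolding N[symmetric] by (intro density_cong) auto
  moreover have "enn2real (min 1 (r x)) \<le> 1" for x
    using enn2real_mono[of "min 1 (r x)" 1] by simp
  ultimately show thesis by (intro that[of "\<lambda>x. enn2real (min 1 (r x))"]) auto
qed

text \<open>Here \<open>g\<close> is a version of the conditional probability of \<open>A\<close> given \<open>X = x\<close>.\<close>
lemma (in prob_space) conditional_probability_given_value:
  fixes X :: "'a \<Rightarrow> real"
  assumes X[measurable]: "X \<in> borel_measurable M" and A[measurable]: "A \<in> events"
  obtains g :: "real \<Rightarrow> real" where "g \<in> borel_measurable borel" "\<And>x. 0 \<le> g x" "\<And>x. g x \<le> 1"
    "\<And>f. f \<in> borel_measurable borel \<Longrightarrow>
      (\<integral>\<omega>. indicator A \<omega> * f (X \<omega>) \<partial>M) = (\<integral>x. g x * f x \<partial>distr M borel X :: real)"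
    "\<And>f. f \<in> borel_measurable borel \<Longrightarrow>
      integrable M (\<lambda>\<omega>. indicator A \<omega> * f (X \<omega>) :: real) \<longleftrightarrow>
      integrable (distr M borel X) (\<lambda>x. g x * f x)"
proof -
  define P where "P = distr M borel X"
  \<comment> \<open>\<open>N\<close> sends \<open>B\<close> to the probability of \<open>A\<close>
    together with the event that \<open>X\<close> lies in \<open>B\<close>. It is left unnormalised
    so that the law \<open>P\<close> of \<open>X\<close> dominates it.\<close>
  define N where "N = distr (density M (\<lambda>\<omega>. ennreal (indicator A \<omega>))) borel X"
  have [simp]: "sets P = sets borel" "space P = UNIV" by (simp_all add: P_def)
  interpret P: prob_space P unfolding P_def by (rule prob_space_distr) simp
  have "emeasure N B \<le> emeasure P B" if B[measurable]: "B \<in> sets P" for B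
  proof -
    have [measurable]: "B \<in> sets borel" using B by simp
    have "emeasure N B = (\<integral>\<^sup>+\<omega>. indicator A \<omega> * indicator (X -` B \<inter> space M) \<omega> \<partial>M)"
      unfolding N_def by (simp add: emeasure_distr emeasure_density ennreal_indicator)
    also have "\<dots> \<le> (\<integral>\<^sup>+\<omega>. indicator (X -` B \<inter> space M) \<omega> \<partial>M)"
      by (intro nn_integral_mono) (auto simp: indicator_def)
    finally show ?thesis by (simp add: P_def emeasure_distr)
  qed
  moreover have "sets N = sets P" by (simp add: N_def)
  ultimately obtain g :: "real \<Rightarrow> real" where g: "g \<in> borel_measurable P" "\<And>x. 0 \<le> g x" "\<And>x. g x \<le> 1"
      "N = density P (\<lambda>x. ennreal (g x))"
    using P.dominated_density[of N] by metis
  have [measurable]: "g \<in> borel_measurable borel" using g(1) by (simp cong: measurable_cong_sets)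
  show thesis
  proof (rule that[of g])
    fix f :: "real \<Rightarrow> real" assume f[measurable]: "f \<in> borel_measurable borel"
    have "(\<integral>\<omega>. indicator A \<omega> * f (X \<omega>) \<partial>M) = (\<integral>x. f x \<partial>N)"
      unfolding N_def by (simp add: integral_distr integral_density)
    also have "\<dots> = (\<integral>x. g x * f x \<partial>P)"
      unfolding g(4) using g(2) by (subst integral_density) (auto simp: P_def)
    finally show "(\<integral>\<omega>. indicator A \<omega> * f (X \<omega>) \<partial>M) = (\<integral>x. g x * f x \<partial>distr M borel X)"
      by (simp add: P_def)
    have "integrable M (\<lambda>\<omega>. indicator A \<omega> * f (X \<omega>)) \<longleftrightarrow> integrable N f"
      unfolding N_def by (simp add: integrable_distr_eq integrable_density)
    also have "\<dots> \<longleftrightarrow> integrable P (\<lambda>x. g x * f x)"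
      unfolding g(4) using g(2) by (subst integrable_density) (auto simp: P_def)
    finally show "integrable M (\<lambda>\<omega>. indicator A \<omega> * f (X \<omega>) :: real) \<longleftrightarrow>
      integrable (distr M borel X) (\<lambda>x. g x * f x)" by (simp add: P_def)
  qed (use g in simp_all)
qed

section \<open>Relative entropy of averaged conditional laws\<close>

text \<open>Densities are unique almost everywhere, so \<open>RN_deriv\<close> may be replaced by
  \<open>h\<close> in the entropy density. Integrability then turns the extended integral into an
  ordinary one.\<close>

lemma (in prob_space) relative_entropy_density:
  fixes h :: "'a \<Rightarrow> real"
  assumes h[measurable]: "h \<in> borel_measurable M" and nonneg: "\<And>x. 0 \<le> h x"
    and int: "integrable M (\<lambda>x. h x * ln (h x))"
  shows "relative_entropy (density M h) M = ereal (\<integral>x. h x * ln (h x) \<partial>M)"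
proof -
  let ?Q = "density M (\<lambda>x. ennreal (h x))"
  have "density M (RN_deriv M ?Q) = ?Q"
    by (intro density_RN_deriv_density) auto
  then have "AE x in M. RN_deriv M ?Q x = h x"
    by (intro density_unique) auto
  then have eq: "AE x in M. h x * entropy_density (exp 1) M ?Q x = h x * ln (h x)"
    by eventually_elim (simp add: entropy_density_def log_def nonneg)
  have [measurable]: "entropy_density (exp 1) M ?Q \<in> borel_measurable M"
    by (auto simp: comp_def entropy_density_def)
  have "integrable M (\<lambda>x. h x * entropy_density (exp 1) M ?Q x)"
    using int eq by (subst integrable_cong_AE) auto
  then have "integrable ?Q (entropy_density (exp 1) M ?Q)"
    using nonneg by (simp add: integrable_density)
  moreover have "(\<integral>x. entropy_density (exp 1) M ?Q x \<partial>?Q) = (\<integral>x. h x * ln (h x) \<partial>M)"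
    using nonneg eq by (simp add: integral_density) (intro integral_cong_AE, auto)
  moreover have "\<exists>f\<in>borel_measurable M. density M f = ?Q"
    by (intro bexI[of _ "\<lambda>x. ennreal (h x)"]) auto
  ultimately show ?thesis
    by (simp add: relative_entropy_def ext_integral_integrable)
qed

text \<open>Makes \<open>h * ln h\<close> integrable for a bounded density on a probability space.
  Applying \<open>ln t \<le> t - 1\<close> at \<open>t = 1 / h\<close> and at \<open>t = h\<close>
  traps \<open>h * ln h\<close> between \<open>h - 1\<close> and \<open>h * h\<close>; the constant
  is deliberately crude.\<close>

lemma abs_mult_ln_le:
  fixes h K :: real
  assumes "0 \<le> h" "h \<le> K"
  shows "\<bar>h * ln h\<bar> \<le> 1 + K\<^sup>2"
proof (cases "h = 0")
  case False
  then have "h > 0" using assms by simp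
  have "h * (1 - 1 / h) \<le> h * ln h"
    using ln_le_minus_one[of "1 / h"] \<open>h > 0\<close> by (intro mult_left_mono) (auto simp: ln_div)
  then have "h - 1 \<le> h * ln h"
    using \<open>h > 0\<close> by (simp add: algebra_simps)
  moreover have "h * ln h \<le> h * h"
    using ln_le_minus_one[of h] \<open>h > 0\<close> by (intro mult_left_mono) auto
  moreover have "h * h \<le> K * K"
    using assms by (intro mult_mono) auto
  ultimately show ?thesis
    using assms zero_le_square[of K] unfolding power2_eq_square abs_le_iff by linarith
qed simp

text \<open>\<open>h\<close> is the density of the average over \<open>i \<in> I\<close> of the conditional laws of \<open>X i\<close> given \<open>A\<close>.\<close>
lemma (in prob_space) averaged_conditional_density:
  fixes X :: "'i \<Rightarrow> 'a \<Rightarrow> real"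
  assumes I: "finite I" "I \<noteq> {}"
    and X: "\<And>i. i \<in> I \<Longrightarrow> X i \<in> borel_measurable M"
    and law: "\<And>i. i \<in> I \<Longrightarrow> distr M borel (X i) = P"
    and A: "A \<in> events" and pos: "prob A > 0"
  obtains h :: "real \<Rightarrow> real" where "h \<in> borel_measurable borel" "\<And>x. 0 \<le> h x" "\<And>x. h x \<le> 1 / prob A"
    "\<And>f i. f \<in> borel_measurable borel \<Longrightarrow> integrable P (\<lambda>x. h x * f x) \<Longrightarrow> i \<in> I \<Longrightarrow>
        integrable M (\<lambda>\<omega>. indicator A \<omega> * f (X i \<omega>) :: real)"
    "\<And>f. f \<in> borel_measurable borel \<Longrightarrow> integrable P (\<lambda>x. h x * f x) \<Longrightarrow>
      real (card I) * prob A * (\<integral>x. h x * f x \<partial>P) = (\<Sum>i\<in>I. \<integral>\<omega>. indicator A \<omega> * f (X i \<omega>) \<partial>M)"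
proof -
  let ?c = "real (card I) * prob A"
  have card: "real (card I) > 0" using I by (simp add: card_gt_0_iff)
  then have c: "?c > 0" using pos by simp
  obtain i0 where "i0 \<in> I" using I by blast
  then have [simp]: "sets P = sets borel" "space P = UNIV" using law[of i0] by auto
  have "\<forall>i\<in>I. \<exists>g :: real \<Rightarrow> real. g \<in> borel_measurable borel \<and> (\<forall>x. 0 \<le> g x) \<and> (\<forall>x. g x \<le> 1) \<and>
      (\<forall>f\<in>borel_measurable borel. (\<integral>\<omega>. indicator A \<omega> * f (X i \<omega>) \<partial>M) = (\<integral>x. g x * f x \<partial>P)) \<and>
      (\<forall>f\<in>borel_measurable borel. integrable M (\<lambda>\<omega>. indicator A \<omega> * f (X i \<omega>)) \<longleftrightarrow> integrable P (\<lambda>x. g x * f x))" (is "\<forall>i\<in>I. ?ex i")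
  proof
    fix i assume i: "i \<in> I"
    obtain g :: "real \<Rightarrow> real" where g: "g \<in> borel_measurable borel" "\<And>x. 0 \<le> g x" "\<And>x. g x \<le> 1"
      "\<And>f. f \<in> borel_measurable borel \<Longrightarrow>
        (\<integral>\<omega>. indicator A \<omega> * f (X i \<omega>) \<partial>M) = (\<integral>x. g x * f x \<partial>distr M borel (X i))"
      "\<And>f. f \<in> borel_measurable borel \<Longrightarrow>
        integrable M (\<lambda>\<omega>. indicator A \<omega> * f (X i \<omega>)) \<longleftrightarrow> integrable (distr M borel (X i)) (\<lambda>x. g x * f x)"
      by (rule conditional_probability_given_value[OF X[OF i] A]) blast
    then show "?ex i"
      unfolding law[OF i] by (intro exI[of _ g] conjI ballI allI)
  qed
  then obtain g :: "'i \<Rightarrow> real \<Rightarrow> real" where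
    g: "\<And>i. i \<in> I \<Longrightarrow> g i \<in> borel_measurable borel" "\<And>i x. i \<in> I \<Longrightarrow> 0 \<le> g i x" "\<And>i x. i \<in> I \<Longrightarrow> g i x \<le> 1"
    and g_integral: "\<And>i f. i \<in> I \<Longrightarrow> f \<in> borel_measurable borel \<Longrightarrow>
      (\<integral>\<omega>. indicator A \<omega> * f (X i \<omega>) \<partial>M) = (\<integral>x. g i x * f x \<partial>P)"
    and g_integrable: "\<And>i f. i \<in> I \<Longrightarrow> f \<in> borel_measurable borel \<Longrightarrow>
      integrable M (\<lambda>\<omega>. indicator A \<omega> * f (X i \<omega>)) \<longleftrightarrow> integrable P (\<lambda>x. g i x * f x)"
    unfolding bchoice_iff by blast
  \<comment> \<open>Each \<open>g i\<close> has \<open>P\<close>-integral \<open>prob A\<close>, so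
    dividing the sum by \<open>?c\<close> gives total mass 1.\<close>
  define h where "h x = (\<Sum>i\<in>I. g i x) / ?c" for x
  have ch: "?c * h x = (\<Sum>i\<in>I. g i x)" for x
    using card pos by (simp add: h_def)
  have h_meas[measurable]: "h \<in> borel_measurable borel"
    unfolding h_def using g(1) by (intro borel_measurable_divide borel_measurable_sum) auto
  have h_nonneg: "0 \<le> h x" for x
    unfolding h_def using g(2) c by (intro divide_nonneg_pos sum_nonneg) auto
  have "h x \<le> 1 / prob A" for x
  proof -
    have "(\<Sum>i\<in>I. g i x) \<le> (\<Sum>i\<in>I. 1)" using g(3) by (intro sum_mono) auto
    then have "h x \<le> real (card I) / ?c"
      unfolding h_def using c by (intro divide_right_mono) auto
    then show ?thesis using card by simp
  qed
  moreover have int: "integrable P (\<lambda>x. g i x * f x)"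
    if f[measurable]: "f \<in> borel_measurable borel" and hf: "integrable P (\<lambda>x. h x * f x)" and i: "i \<in> I" for f :: "real \<Rightarrow> real" and i
  proof (rule Bochner_Integration.integrable_bound)
    show "integrable P (\<lambda>x. ?c * (h x * f x))" using hf by simp
    show "(\<lambda>x. g i x * f x) \<in> borel_measurable P"
      using g(1)[OF i] by (intro borel_measurable_times) (simp_all cong: measurable_cong_sets)
    \<comment> \<open>A single summand is at most the sum of nonnegative ones, so integrability
      against \<open>h\<close> passes to every \<open>g i\<close>.\<close>
    have "g i x \<le> ?c * h x" for x
      unfolding ch using g(2) i I by (intro member_le_sum) auto
    then have "g i x * \<bar>f x\<bar> \<le> ?c * h x * \<bar>f x\<bar>" for x
      by (intro mult_right_mono) auto
    then show "AE x in P. norm (g i x * f x) \<le> norm (?c * (h x * f x))"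
      using g(2)[OF i] h_nonneg by (simp add: abs_mult mult.assoc)
  qed
  moreover have "?c * (\<integral>x. h x * f x \<partial>P) = (\<Sum>i\<in>I. \<integral>\<omega>. indicator A \<omega> * f (X i \<omega>) \<partial>M)"
    if f: "f \<in> borel_measurable borel" and hf: "integrable P (\<lambda>x. h x * f x)" for f :: "real \<Rightarrow> real"
  proof -
    have "?c * (\<integral>x. h x * f x \<partial>P) = (\<integral>x. ?c * h x * f x \<partial>P)"
      by (simp add: mult.assoc)
    also have "\<dots> = (\<integral>x. (\<Sum>i\<in>I. g i x * f x) \<partial>P)"
      unfolding ch by (simp add: sum_distrib_right)
    also have "\<dots> = (\<Sum>i\<in>I. \<integral>x. g i x * f x \<partial>P)"
      using int[OF f hf] by (intro Bochner_Integration.integral_sum)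
    finally show ?thesis using g_integral[OF _ f] by simp
  qed
  ultimately show thesis
    using g_integrable by (intro that[OF h_meas h_nonneg]) auto
qed

text \<open>
  Jensen's inequality for the logarithm enters as \<open>ln (p V) \<le> p V - 1\<close>, integrated over \<open>A\<close>.
\<close>
lemma (in prob_space) averaged_conditional_entropy:
  fixes X :: "'i \<Rightarrow> 'a \<Rightarrow> real"
  assumes I: "finite I" "I \<noteq> {}"
    and indep: "indep_vars (\<lambda>_. borel) X I"
    and law: "\<And>i. i \<in> I \<Longrightarrow> distr M borel (X i) = P"
    and A[measurable]: "A \<in> events" and pos: "prob A > 0"
  obtains Q where "prob_space Q" "sets Q = sets borel"
    "relative_entropy Q P \<le> ereal (- ln (prob A) / real (card I))"
    "\<And>f :: real \<Rightarrow> real. f \<in> borel_measurable borel \<Longrightarrow> integrable P f \<Longrightarrow> integrable Q f"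
    "\<And>f. f \<in> borel_measurable borel \<Longrightarrow> integrable P f \<Longrightarrow>
      real (card I) * prob A * (\<integral>x. f x \<partial>Q) = (\<integral>\<omega>. indicator A \<omega> * (\<Sum>i\<in>I. f (X i \<omega>)) \<partial>M)"
proof -
  define p where "p = prob A"
  let ?n = "real (card I)"
  have n: "?n > 0" using I by (simp add: card_gt_0_iff)
  have p: "p > 0" using pos by (simp add: p_def)
  have X: "X i \<in> borel_measurable M" if "i \<in> I" for i
    using indep that by (auto simp: indep_vars_def)
  obtain h :: "real \<Rightarrow> real" where h[measurable]: "h \<in> borel_measurable borel"
    and h_nonneg: "\<And>x. 0 \<le> h x" and h_le: "\<And>x. h x \<le> 1 / p"
    and h_integrable: "\<And>f i. f \<in> borel_measurable borel \<Longrightarrow> integrable P (\<lambda>x. h x * f x) \<Longrightarrow> i \<in> I \<Longrightarrow>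
        integrable M (\<lambda>\<omega>. indicator A \<omega> * f (X i \<omega>) :: real)"
    and h_integral: "\<And>f. f \<in> borel_measurable borel \<Longrightarrow> integrable P (\<lambda>x. h x * f x) \<Longrightarrow>
      ?n * p * (\<integral>x. h x * f x \<partial>P) = (\<Sum>i\<in>I. \<integral>\<omega>. indicator A \<omega> * f (X i \<omega>) \<partial>M)"
    by (rule averaged_conditional_density[where X = X, OF I X law A pos, folded p_def]) (assumption | (rule that; assumption))+
  obtain i0 where i0: "i0 \<in> I" using I by blast
  have [simp, measurable_cong]: "sets P = sets borel" and [simp]: "space P = UNIV"
    using law[OF i0] by auto
  interpret P: prob_space P
    using prob_space_distr[of "X i0" borel] X[OF i0] law[OF i0] by simp
  have hf_integrable: "integrable P (\<lambda>x. h x * f x)"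
    if [measurable]: "f \<in> borel_measurable borel" and f: "integrable P f" for f :: "real \<Rightarrow> real"
  proof (rule Bochner_Integration.integrable_bound)
    show "integrable P (\<lambda>x. 1 / p * f x)" using f by simp
    have "h x * \<bar>f x\<bar> \<le> 1 / p * \<bar>f x\<bar>" for x
      using h_le by (intro mult_right_mono) auto
    then show "AE x in P. norm (h x * f x) \<le> norm (1 / p * f x)"
      using h_nonneg p by (simp add: abs_mult)
  qed measurable
  have h_int: "integrable P h" using hf_integrable[of "\<lambda>_. 1"] by simp
  have "?n * p * (\<integral>x. h x * 1 \<partial>P) = ?n * p"
    using h_integral[of "\<lambda>_. 1"] h_int by (simp add: p_def)
  then have h_one: "(\<integral>x. h x \<partial>P) = 1" using n p by simp
  have hln_int: "integrable P (\<lambda>x. h x * ln (h x))"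
    by (rule P.integrable_const_bound[of _ "1 + (1 / p)\<^sup>2"])
      (use abs_mult_ln_le[OF h_nonneg h_le] in auto)
  \<comment> \<open>The logarithm of the product splits only for positive factors. Testing
    \<open>h_integral\<close> with the indicator of the zero set of \<open>h\<close> gives 0 on the
    left, so each nonnegative term on the right vanishes: on \<open>A\<close>, almost surely no
    \<open>X i\<close> hits that set.\<close>
  have "AE \<omega> in M. \<omega> \<in> A \<longrightarrow> 0 < h (X i \<omega>)" if i: "i \<in> I" for i
  proof -
    let ?f = "indicator {x. h x = 0} :: real \<Rightarrow> real"
    have zero: "(\<lambda>x. h x * ?f x) = (\<lambda>_. 0)" by (auto simp: indicator_def)
    have "(\<Sum>i\<in>I. \<integral>\<omega>. indicator A \<omega> * ?f (X i \<omega>) \<partial>M) = 0"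
      using h_integral[of ?f] unfolding zero by simp
    then have "(\<integral>\<omega>. indicator A \<omega> * ?f (X i \<omega>) \<partial>M) = 0"
      using I i by (subst (asm) sum_nonneg_eq_0_iff) auto
    moreover have "integrable M (\<lambda>\<omega>. indicator A \<omega> * ?f (X i \<omega>))"
      by (rule h_integrable[OF _ _ i]) (simp_all add: zero)
    ultimately have "AE \<omega> in M. indicator A \<omega> * ?f (X i \<omega>) = 0"
      by (subst (asm) integral_nonneg_eq_0_iff_AE) auto
    then show ?thesis
    proof eventually_elim
      case (elim \<omega>)
      then show ?case using h_nonneg[of "X i \<omega>"] by (auto simp: indicator_def less_le split: if_splits)
    qed
  qed
  then have h_pos: "AE \<omega> in M. \<forall>i\<in>I. \<omega> \<in> A \<longrightarrow> 0 < h (X i \<omega>)"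
    using I by (subst AE_finite_all) auto
  define V where "V \<omega> = (\<Prod>i\<in>I. h (X i \<omega>))" for \<omega>
  have V_nonneg: "0 \<le> V \<omega>" for \<omega> unfolding V_def by (intro prod_nonneg) (simp add: h_nonneg)
  have indep_h: "indep_vars (\<lambda>_. borel) (\<lambda>i \<omega>. h (X i \<omega>)) I"
    by (rule indep_vars_compose2[OF indep]) simp
  have hX_int: "integrable M (\<lambda>\<omega>. h (X i \<omega>))" and hX_one: "(\<integral>\<omega>. h (X i \<omega>) \<partial>M) = 1" if "i \<in> I" for i
    using h_int h_one X[OF that] unfolding law[OF that, symmetric]
    by (simp_all add: integrable_distr_eq integral_distr)
  have V_int: "integrable M V" and V_one: "(\<integral>\<omega>. V \<omega> \<partial>M) = 1"
    unfolding V_def using indep_vars_integrable[OF I(1) indep_h hX_int]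
      indep_vars_lebesgue_integral[OF I(1) indep_h hX_int] hX_one by simp_all
  have ln_int: "integrable M (\<lambda>\<omega>. indicator A \<omega> * ln (h (X i \<omega>)))" if "i \<in> I" for i
    by (rule h_integrable[OF _ hln_int that]) simp
  have A_int: "integrable M (\<lambda>\<omega>. indicator A \<omega> * V \<omega>)"
    using integrable_mult_indicator[OF A V_int] by simp
  \<comment> \<open>The factor \<open>p\<close> is the right scaling: the mean of \<open>V\<close>
    given \<open>A\<close> is at most \<open>1 / p\<close>, so the tangent bound for the logarithm
    at 1 loses nothing in the final constant.\<close>
  have "(\<integral>\<omega>. (\<Sum>i\<in>I. indicator A \<omega> * ln (h (X i \<omega>))) + indicator A \<omega> * ln p \<partial>M)
      \<le> (\<integral>\<omega>. p * (indicator A \<omega> * V \<omega>) - indicator A \<omega> \<partial>M)"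
  proof (rule integral_mono_AE)
    show "AE \<omega> in M. (\<Sum>i\<in>I. indicator A \<omega> * ln (h (X i \<omega>))) + indicator A \<omega> * ln p
        \<le> p * (indicator A \<omega> * V \<omega>) - indicator A \<omega>"
      using h_pos
    proof eventually_elim
      case (elim \<omega>)
      show ?case
      proof (cases "\<omega> \<in> A")
        case True
        then have V: "V \<omega> > 0" using elim unfolding V_def by (intro prod_pos) auto
        have "(\<Sum>i\<in>I. ln (h (X i \<omega>))) = ln (V \<omega>)"
          unfolding V_def using elim True I by (subst ln_prod) auto
        then have "(\<Sum>i\<in>I. ln (h (X i \<omega>))) + ln p = ln (p * V \<omega>)"
          using V p by (simp add: ln_mult)
        also have "\<dots> \<le> p * V \<omega> - 1"
          using V p by (intro ln_le_minus_one) simp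
        finally show ?thesis using True by simp
      qed simp
    qed
  qed (use ln_int A_int in \<open>auto intro!: Bochner_Integration.integrable_add Bochner_Integration.integrable_diff
      Bochner_Integration.integrable_sum simp: less_top[symmetric]\<close>)
  moreover have "(\<integral>\<omega>. (\<Sum>i\<in>I. indicator A \<omega> * ln (h (X i \<omega>))) + indicator A \<omega> * ln p \<partial>M)
      = (\<Sum>i\<in>I. \<integral>\<omega>. indicator A \<omega> * ln (h (X i \<omega>)) \<partial>M) + p * ln p"
    using ln_int by (subst Bochner_Integration.integral_add) (auto simp: p_def less_top[symmetric])
  moreover have "(\<integral>\<omega>. p * (indicator A \<omega> * V \<omega>) - indicator A \<omega> \<partial>M)
      = p * (\<integral>\<omega>. indicator A \<omega> * V \<omega> \<partial>M) - p"
    using A_int by (subst Bochner_Integration.integral_diff) (auto simp: p_def less_top[symmetric])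
  \<comment> \<open>Since \<open>V\<close> is nonnegative with mean 1, enlarging \<open>A\<close> to
    the whole space bounds the first term by \<open>p\<close>, which cancels against
    \<open>- p\<close>.\<close>
  moreover have "(\<integral>\<omega>. indicator A \<omega> * V \<omega> \<partial>M) \<le> (\<integral>\<omega>. V \<omega> \<partial>M)"
    using A_int V_int V_nonneg by (intro integral_mono) (auto simp: indicator_def)
  then have "p * (\<integral>\<omega>. indicator A \<omega> * V \<omega> \<partial>M) \<le> p"
    using V_one p by simp
  \<comment> \<open>With the test function \<open>ln (h x)\<close>, \<open>h_integral\<close> turns
    the sum of conditional log-likelihoods into \<open>?n * p\<close> times the relative
    entropy.\<close>
  ultimately have "?n * p * (\<integral>x. h x * ln (h x) \<partial>P) + p * ln p \<le> 0"
    using h_integral[OF _ hln_int] by simp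
  then have "p * (?n * (\<integral>x. h x * ln (h x) \<partial>P) + ln p) \<le> 0"
    by (simp add: algebra_simps)
  then have "?n * (\<integral>x. h x * ln (h x) \<partial>P) + ln p \<le> 0"
    using p by (simp only: mult_le_0_iff) linarith
  then have "(\<integral>x. h x * ln (h x) \<partial>P) \<le> - ln p / ?n"
    by (subst pos_le_divide_eq[OF n]) (simp add: mult.commute)
  then have entropy: "relative_entropy (density P h) P \<le> ereal (- ln p / ?n)"
    using P.relative_entropy_density[OF _ h_nonneg hln_int] by simp
  have prob: "prob_space (density P h)"
    using h_nonneg h_int h_one
    by (intro prob_spaceI) (simp add: emeasure_density nn_integral_eq_integral)
  have int: "integrable (density P h) f" if "f \<in> borel_measurable borel" "integrable P f" for f :: "real \<Rightarrow> real"
    using hf_integrable[OF that] that h_nonneg by (subst integrable_density) auto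
  have mean: "?n * p * (\<integral>x. f x \<partial>density P h) = (\<integral>\<omega>. indicator A \<omega> * (\<Sum>i\<in>I. f (X i \<omega>)) \<partial>M)"
    if f: "f \<in> borel_measurable borel" "integrable P f" for f :: "real \<Rightarrow> real"
  proof -
    have "(\<integral>x. f x \<partial>density P h) = (\<integral>x. h x * f x \<partial>P)"
      using f(1) h_nonneg by (subst integral_density) auto
    then have "?n * p * (\<integral>x. f x \<partial>density P h) = (\<Sum>i\<in>I. \<integral>\<omega>. indicator A \<omega> * f (X i \<omega>) \<partial>M)"
      using h_integral[OF f(1) hf_integrable[OF f]] by simp
    also have "\<dots> = (\<integral>\<omega>. (\<Sum>i\<in>I. indicator A \<omega> * f (X i \<omega>)) \<partial>M)"
      using h_integrable[OF f(1) hf_integrable[OF f]] by simp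
    finally show ?thesis by (simp add: sum_distrib_left)
  qed
  have sets: "sets (density P h) = sets borel" by simp
  show thesis
    by (rule that[of "density P h", folded p_def]) (fact prob sets entropy | erule (1) int | erule (1) mean)+
qed

section \<open>Chernoff's bound and small exponential moments\<close>

text \<open>Markov's inequality for the product, whose mean factors by independence. Working in
  \<open>ennreal\<close> allows the common mean \<open>J\<close> to be infinite.\<close>

lemma (in prob_space) chernoff_product:
  fixes W :: "'i \<Rightarrow> 'a \<Rightarrow> real"
  assumes "finite I" "indep_vars (\<lambda>_. borel) W I" "\<And>i \<omega>. i \<in> I \<Longrightarrow> 0 \<le> W i \<omega>"
    and J: "\<And>i. i \<in> I \<Longrightarrow> (\<integral>\<^sup>+\<omega>. ennreal (W i \<omega>) \<partial>M) = J"
    and A[measurable]: "A \<in> events" and c: "\<And>\<omega>. \<omega> \<in> A \<Longrightarrow> c \<le> (\<Prod>i\<in>I. W i \<omega>)"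
  shows "ennreal c * emeasure M A \<le> J ^ card I"
proof -
  have "ennreal c * emeasure M A = (\<integral>\<^sup>+\<omega>. ennreal c * indicator A \<omega> \<partial>M)"
    by (simp add: nn_integral_cmult)
  also have "\<dots> \<le> (\<integral>\<^sup>+\<omega>. (\<Prod>i\<in>I. ennreal (W i \<omega>)) \<partial>M)"
    using c assms(3) by (intro nn_integral_mono) (auto simp: indicator_def prod_ennreal intro!: ennreal_leI)
  also have "\<dots> = (\<Prod>i\<in>I. \<integral>\<^sup>+\<omega>. ennreal (W i \<omega>) \<partial>M)"
    using assms(1) by (intro indep_vars_nn_integral indep_vars_compose2[OF assms(2)]) auto
  also have "\<dots> = J ^ card I" using J by simp
  finally show ?thesis .
qed

text \<open>Both bounds are \<open>1 + x \<le> exp x\<close>, at \<open>x = d / Suc k\<close> and at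
  its negative. They serve to sandwich the difference quotients of the exponential at 0 and to
  dominate them uniformly in \<open>k\<close>.\<close>

lemma exp_difference_quotient_bounds:
  fixes d :: real and k :: nat
  shows "d \<le> real (Suc k) * (exp (d / real (Suc k)) - 1)"
    and "real (Suc k) * (exp (d / real (Suc k)) - 1) \<le> d * exp (d / real (Suc k))"
proof -
  let ?k = "real (Suc k)"
  have k: "?k > 0" by simp
  have "d / ?k \<le> exp (d / ?k) - 1"
    using exp_ge_add_one_self[of "d / ?k"] by linarith
  then have "?k * (d / ?k) \<le> ?k * (exp (d / ?k) - 1)"
    by (intro mult_left_mono) auto
  then show "d \<le> ?k * (exp (d / ?k) - 1)" using k by (simp del: of_nat_Suc)
  have "(1 - d / ?k) * exp (d / ?k) \<le> exp (- (d / ?k)) * exp (d / ?k)"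
    using exp_ge_add_one_self[of "- (d / ?k)"] by (intro mult_right_mono) auto
  also have "\<dots> = 1" by (simp flip: exp_add)
  finally have "?k * (exp (d / ?k) - 1) \<le> ?k * (d / ?k * exp (d / ?k))"
    by (intro mult_left_mono) (auto simp: algebra_simps)
  then show "?k * (exp (d / ?k) - 1) \<le> d * exp (d / ?k)"
    using k by (simp del: of_nat_Suc)
qed

text \<open>The moment generating function of \<open>Z - b\<close> is 1 at 0 and has right
  derivative \<open>expectation Z - b\<close>, which is negative, so it drops below 1 at some
  \<open>1 / Suc k\<close>. The upper bound \<open>c\<close> on \<open>Z\<close> permits dominated
  convergence for the difference quotients \<open>f k\<close>.\<close>

lemma (in prob_space) exponential_moment_less:
  fixes Z :: "'a \<Rightarrow> real"
  assumes Z[measurable]: "integrable M Z" and bdd: "AE \<omega> in M. Z \<omega> \<le> c" and less: "expectation Z < b"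
  obtains \<theta> where "\<theta> > 0" "(\<integral>\<^sup>+\<omega>. ennreal (exp (\<theta> * Z \<omega>)) \<partial>M) < ennreal (exp (\<theta> * b))"
proof -
  define D where "D \<omega> = Z \<omega> - b" for \<omega>
  \<comment> \<open>The maximum with 0 ensures that dividing by \<open>Suc k\<close> cannot raise
    the bound, so \<open>K\<close> serves for all \<open>k\<close> at once.\<close>
  define K where "K = max 0 (c - b)"
  define f where "f k \<omega> = real (Suc k) * (exp (D \<omega> / real (Suc k)) - 1)" for k \<omega>
  have [measurable]: "D \<in> borel_measurable M" and D: "integrable M D" "expectation D < 0"
    unfolding D_def using Z less by (auto simp: prob_space)
  have [measurable]: "f k \<in> borel_measurable M" for k unfolding f_def by measurable
  have lower: "D \<omega> \<le> f k \<omega>" and upper: "f k \<omega> \<le> D \<omega> * exp (D \<omega> / real (Suc k))" for k \<omega>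
    unfolding f_def by (fact exp_difference_quotient_bounds)+
  have bound: "AE \<omega> in M. norm (f k \<omega>) \<le> exp K * \<bar>D \<omega>\<bar>" for k
    using bdd
  proof eventually_elim
    case (elim \<omega>)
    have "D \<omega> \<le> K" and "0 \<le> K" using elim by (auto simp: D_def K_def)
    have "D \<omega> / real (Suc k) \<le> K / real (Suc k)"
      using \<open>D \<omega> \<le> K\<close> by (intro divide_right_mono) auto
    also have "\<dots> \<le> K / 1"
      using \<open>0 \<le> K\<close> by (intro divide_left_mono) auto
    finally have "D \<omega> / real (Suc k) \<le> K" by simp
    then have "exp (D \<omega> / real (Suc k)) \<le> exp K" by simp
    then have "D \<omega> * exp (D \<omega> / real (Suc k)) \<le> \<bar>D \<omega>\<bar> * exp K"
      by (meson abs_ge_self abs_ge_zero exp_ge_zero mult_mono)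
    moreover have "\<bar>D \<omega>\<bar> * 1 \<le> \<bar>D \<omega>\<bar> * exp K"
      using \<open>0 \<le> K\<close> by (intro mult_left_mono) auto
    ultimately show ?case
      using lower[of \<omega> k] upper[of k \<omega>] by (simp add: mult.commute abs_le_iff)
  qed
  have dom: "integrable M (\<lambda>\<omega>. exp K * \<bar>D \<omega>\<bar>)" using D by simp
  have "(\<lambda>k. f k \<omega>) \<longlonglongrightarrow> D \<omega>" for \<omega>
  proof (rule tendsto_sandwich[of "\<lambda>_. D \<omega>"])
    have "(\<lambda>k. D \<omega> / real (Suc k)) \<longlonglongrightarrow> 0"
      using tendsto_mult[OF tendsto_const LIMSEQ_inverse_real_of_nat, of "D \<omega>"] by (simp add: divide_inverse)
    from tendsto_mult[OF tendsto_const tendsto_exp[OF this], of "D \<omega>"]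
    show "(\<lambda>k. D \<omega> * exp (D \<omega> / real (Suc k))) \<longlonglongrightarrow> D \<omega>" by simp
  qed (use lower upper in auto)
  then have "(\<lambda>k. expectation (f k)) \<longlonglongrightarrow> expectation D"
    using dom bound by (intro integral_dominated_convergence[where w = "\<lambda>\<omega>. exp K * \<bar>D \<omega>\<bar>"]) auto
  then have "eventually (\<lambda>k. expectation (f k) < 0) sequentially"
    using D(2) by (rule order_tendstoD(2))
  then obtain k where k: "expectation (f k) < 0" by (auto simp: eventually_sequentially)
  let ?t = "1 / real (Suc k)"
  have "integrable M (f k)"
    by (rule Bochner_Integration.integrable_bound[OF dom]) (use bound[of k] in auto)
  moreover have exp_eq: "exp (?t * D \<omega>) = ?t * f k \<omega> + 1" for \<omega> unfolding f_def by simp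
  ultimately have int: "integrable M (\<lambda>\<omega>. exp (?t * D \<omega>))"
    and "expectation (\<lambda>\<omega>. exp (?t * D \<omega>)) = ?t * expectation (f k) + 1"
    by (simp_all add: prob_space)
  moreover have "?t * expectation (f k) < 0" using k by (intro mult_pos_neg) auto
  ultimately have lt1: "expectation (\<lambda>\<omega>. exp (?t * D \<omega>)) < 1" by simp
  have "(\<integral>\<^sup>+\<omega>. ennreal (exp (?t * Z \<omega>)) \<partial>M) = (\<integral>\<^sup>+\<omega>. ennreal (exp (?t * b) * exp (?t * D \<omega>)) \<partial>M)"
    by (intro nn_integral_cong) (simp add: D_def right_diff_distrib flip: exp_add)
  also have "\<dots> = ennreal (exp (?t * b) * expectation (\<lambda>\<omega>. exp (?t * D \<omega>)))"
    using int by (subst nn_integral_eq_integral) auto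
  also have "\<dots> < ennreal (exp (?t * b))"
    using lt1 by (intro ennreal_lessI) auto
  finally show thesis by (intro that[of ?t]) auto
qed

lemma ennreal_log_less:
  assumes "x < ennreal (exp a)"
  shows "ennreal_log x < ereal a"
proof (cases x)
  case (real r)
  then have "r < exp a" using assms by (simp add: ennreal_less_iff)
  then have "r > 0 \<Longrightarrow> ln r < a"
    using ln_less_cancel_iff[of r "exp a"] by simp
  then show ?thesis using real by (auto simp: ennreal_log_def)
qed (use assms in simp)

section \<open>Strict mean constraints, and the proof of the three claims\<close>

text \<open>Positive measure of \<open>A\<close> keeps the inequality strict after integration, as
  the strict constraints defining \<open>E\<close> demand.\<close>

lemma (in finite_measure) restricted_integral_less:
  fixes f g :: "'a \<Rightarrow> real"
  assumes "integrable M f" "integrable M g" and A: "A \<in> sets M" "measure M A > 0"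
    and less: "\<And>\<omega>. \<omega> \<in> A \<Longrightarrow> f \<omega> < g \<omega>"
  shows "(\<integral>\<omega>. indicator A \<omega> * f \<omega> \<partial>M) < (\<integral>\<omega>. indicator A \<omega> * g \<omega> \<partial>M)"
proof (rule integral_less_AE[where A = A])
  show "integrable M (\<lambda>\<omega>. indicator A \<omega> * f \<omega>)" "integrable M (\<lambda>\<omega>. indicator A \<omega> * g \<omega>)"
    using integrable_mult_indicator[OF A(1)] assms(1,2) by (simp_all flip: real_scaleR_def)
  show "emeasure M A \<noteq> 0" using A(2) by (simp add: emeasure_eq_measure)
  show "AE \<omega> in M. \<omega> \<in> A \<longrightarrow> indicator A \<omega> * f \<omega> \<noteq> indicator A \<omega> * g \<omega>"
    by (intro AE_I2) (auto dest: less)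
  show "AE \<omega> in M. indicator A \<omega> * f \<omega> \<le> indicator A \<omega> * g \<omega>"
    by (intro AE_I2) (auto simp: indicator_def dest: less)
qed (fact A)

theorem theorem2p2:
  fixes M :: "'a measure" and P :: "real measure"
    and X :: "nat \<Rightarrow> 'a \<Rightarrow> real"
    and F U :: "real \<Rightarrow> real"
    and S T :: "nat \<Rightarrow> 'a \<Rightarrow> real"
    and \<mu> \<nu> \<epsilon> u :: real
  assumes prob: "prob_space M"
    and indep: "prob_space.indep_vars M (\<lambda>_. borel) X UNIV"
    and law: "\<And>i. distr M borel (X i) = P"
    and F_measurable: "F \<in> borel_measurable borel"
    and U_measurable: "U \<in> borel_measurable borel"
    and F_finite: "integrable M (\<lambda>\<omega>. F (X 0 \<omega>))"
    and U_finite: "integrable M (\<lambda>\<omega>. U (X 0 \<omega>))"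
    and mu: "\<mu> = (\<integral>\<omega>. F (X 0 \<omega>) \<partial>M)"
    and nu: "\<nu> = (\<integral>\<omega>. U (X 0 \<omega>) \<partial>M)"
    and m_finite: "\<And>\<beta>::real. \<beta> > 0 \<Longrightarrow> esssup P (\<lambda>x. ereal (F x - \<beta> * U x)) < \<infinity>"
    and S: "\<And>n \<omega>. S n \<omega> = (\<Sum>i=1..n. F (X i \<omega>))"
    and T: "\<And>n \<omega>. T n \<omega> = (\<Sum>i=1..n. U (X i \<omega>))"
    and eps: "\<epsilon> > 0"
    and u: "u > 0"
  shows "(\<forall>n\<ge>1. ereal (measure M {\<omega> \<in> space M. S n \<omega> - real n * \<mu> > real n * \<epsilon> \<and>
                                                T n \<omega> - real n * \<nu> < real n * u})
            \<le> ereal_exp (- (ereal (real n) *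
                  set_relative_entropy (constraint_set F U \<mu> \<nu> \<epsilon> u) P)))
       \<and> (\<forall>n\<ge>1. ereal (measure M {\<omega> \<in> space M. S n \<omega> - real n * \<mu> > real n * \<epsilon> \<and>
                                                T n \<omega> - real n * \<nu> < real n * u})
            \<le> ereal_exp (- (ereal (real n) * Lambda_plus_star M (X 0) F U \<mu> \<nu> \<epsilon> u)))
       \<and> Lambda_plus_star M (X 0) F U \<mu> \<nu> \<epsilon> u > 0"
proof -
  interpret prob_space M by (rule prob)
  note [measurable] = F_measurable U_measurable
  have X[measurable]: "X i \<in> borel_measurable M" for i
    using indep by (auto simp: indep_vars_def)
  have indep_I: "indep_vars (\<lambda>_. borel) X I" for I
    by (rule indep_vars_subset[OF indep]) simp
  \<comment> \<open>The moments are assumed along \<open>X 0\<close>, while the sums run over the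
    indices 1 to \<open>n\<close>; the common law carries integrability across.\<close>
  have P_integrable: "integrable P f \<longleftrightarrow> integrable M (\<lambda>\<omega>. f (X i \<omega>))"
    if "f \<in> borel_measurable borel" for f :: "real \<Rightarrow> real" and i
    unfolding law[of i, symmetric] using that by (simp add: integrable_distr_eq)
  have F_int: "integrable P F" "integrable M (\<lambda>\<omega>. F (X i \<omega>))" for i
    using F_finite P_integrable[OF F_measurable] by auto
  have U_int: "integrable P U" "integrable M (\<lambda>\<omega>. U (X i \<omega>))" for i
    using U_finite P_integrable[OF U_measurable] by auto
  have S_int: "integrable M (S n)" and T_int: "integrable M (T n)" for n
    using F_int U_int by (simp_all add: S[abs_def] T[abs_def])
  define A where "A n = {\<omega> \<in> space M. S n \<omega> - real n * \<mu> > real n * \<epsilon> \<and> T n \<omega> - real n * \<nu> < real n * u}" for n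
  have A[measurable]: "A n \<in> events" for n
    using S_int[of n] T_int[of n] unfolding A_def by measurable
  have A_S: "real n * (\<mu> + \<epsilon>) < S n \<omega>" and A_T: "T n \<omega> < real n * (\<nu> + u)" if "\<omega> \<in> A n" for n \<omega>
    using that by (auto simp: A_def algebra_simps)
  have entropy: "set_relative_entropy (constraint_set F U \<mu> \<nu> \<epsilon> u) P \<le> ereal (- ln (prob (A n)) / real n)"
    if n: "n \<ge> 1" and pos: "prob (A n) > 0" for n
  proof -
    have "{1..n} \<noteq> {}" using n by simp
    note conditioned = averaged_conditional_entropy[of "{1..n}" X P,
        OF finite_atLeastAtMost this indep_I law A[of n] pos, unfolded card_atLeastAtMost diff_Suc_1]
    obtain Q where Q: "prob_space Q" "sets Q = sets borel"
        "relative_entropy Q P \<le> ereal (- ln (prob (A n)) / real n)"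
      and Q_int: "\<And>f :: real \<Rightarrow> real. f \<in> borel_measurable borel \<Longrightarrow> integrable P f \<Longrightarrow> integrable Q f"
      and Q_mean: "\<And>f. f \<in> borel_measurable borel \<Longrightarrow> integrable P f \<Longrightarrow>
        real n * prob (A n) * (\<integral>x. f x \<partial>Q) = (\<integral>\<omega>. indicator (A n) \<omega> * (\<Sum>i=1..n. f (X i \<omega>)) \<partial>M)"
      by (rule conditioned) (rule that; assumption)
    have np: "real n * prob (A n) > 0" using n pos by simp
    \<comment> \<open>By \<open>Q_mean\<close> the right-hand side is
      \<open>real n * prob (A n)\<close> times the mean of \<open>F\<close> under \<open>Q\<close>,
      so cancelling that factor gives the first constraint. The second, for \<open>U\<close>, is
      obtained in the same way.\<close>
    have "(\<integral>\<omega>. indicator (A n) \<omega> * (real n * (\<mu> + \<epsilon>)) \<partial>M) < (\<integral>\<omega>. indicator (A n) \<omega> * S n \<omega> \<partial>M)"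
      by (rule restricted_integral_less[OF _ _ A pos]) (use S_int A_S in auto)
    then have "real n * prob (A n) * (\<mu> + \<epsilon>) < real n * prob (A n) * (\<integral>x. F x \<partial>Q)"
      using Q_mean[OF F_measurable F_int(1)] by (simp add: S mult_ac)
    then have "\<mu> + \<epsilon> < (\<integral>x. F x \<partial>Q)"
      by (simp only: mult_less_cancel_left_pos[OF np])
    moreover have "(\<integral>\<omega>. indicator (A n) \<omega> * T n \<omega> \<partial>M) < (\<integral>\<omega>. indicator (A n) \<omega> * (real n * (\<nu> + u)) \<partial>M)"
      by (rule restricted_integral_less[OF _ _ A pos]) (use T_int A_T in auto)
    then have "real n * prob (A n) * (\<integral>x. U x \<partial>Q) < real n * prob (A n) * (\<nu> + u)"
      using Q_mean[OF U_measurable U_int(1)] by (simp add: T mult_ac)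
    then have "(\<integral>x. U x \<partial>Q) < \<nu> + u"
      by (simp only: mult_less_cancel_left_pos[OF np])
    ultimately have "Q \<in> constraint_set F U \<mu> \<nu> \<epsilon> u"
      using Q Q_int[OF F_measurable F_int(1)] Q_int[OF U_measurable U_int(1)]
      by (simp add: constraint_set_def ext_integral_integrable)
    then show ?thesis
      unfolding set_relative_entropy_def using Q(3) by (rule INF_lower2)
  qed
  have chernoff: "Lambda_plus_star M (X 0) F U \<mu> \<nu> \<epsilon> u \<le> ereal (- ln (prob (A n)) / real n)"
    if n: "n \<ge> 1" and pos: "prob (A n) > 0" for n
    unfolding Lambda_plus_star_def
  proof (rule SUP_least, clarsimp)
    fix s t :: real assume st: "0 \<le> s" "0 \<le> t"
    let ?a = "s * (\<mu> + \<epsilon>) - t * (\<nu> + u)"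
    let ?W = "\<lambda>x. exp (s * F x - t * U x)"
    define J where "J = (\<integral>\<^sup>+\<omega>. ennreal (?W (X 0 \<omega>)) \<partial>M)"
    have J: "(\<integral>\<^sup>+\<omega>. ennreal (?W (X i \<omega>)) \<partial>M) = J" for i
    proof -
      have "(\<integral>\<^sup>+\<omega>. ennreal (?W (X i \<omega>)) \<partial>M) = (\<integral>\<^sup>+x. ennreal (?W x) \<partial>P)" for i
        unfolding law[of i, symmetric] by (subst nn_integral_distr) auto
      then show ?thesis by (simp add: J_def)
    qed
    have "ennreal (exp (real n * ?a)) * emeasure M (A n) \<le> J ^ card {1..n}"
    proof (rule chernoff_product[OF _ _ _ J A])
      show "indep_vars (\<lambda>_. borel) (\<lambda>i \<omega>. ?W (X i \<omega>)) {1..n}"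
        by (rule indep_vars_compose2[OF indep_I]) simp
      fix \<omega> assume \<omega>: "\<omega> \<in> A n"
      \<comment> \<open>Nonnegative multipliers preserve the directions of both inequalities, which
        merge into one lower bound on the exponent.\<close>
      have "s * (real n * (\<mu> + \<epsilon>)) \<le> s * S n \<omega>" "t * T n \<omega> \<le> t * (real n * (\<nu> + u))"
        using st A_S[OF \<omega>] A_T[OF \<omega>] by (auto intro!: mult_left_mono)
      then have "real n * ?a \<le> s * S n \<omega> - t * T n \<omega>"
        by (simp add: algebra_simps)
      also have "\<dots> = (\<Sum>i=1..n. s * F (X i \<omega>) - t * U (X i \<omega>))"
        by (simp add: S T sum_subtractf sum_distrib_left)
      finally show "exp (real n * ?a) \<le> (\<Prod>i=1..n. ?W (X i \<omega>))"
        by (simp flip: exp_sum)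
    qed auto
    then have main: "ennreal (exp (real n * ?a) * prob (A n)) \<le> J ^ n"
      by (simp add: emeasure_eq_measure ennreal_mult)
    show "ereal ?a - Lambda_plus M (X 0) F U s t \<le> ereal (- (ln (prob (A n)) / real n))"
    \<comment> \<open>For finite \<open>J\<close>, positivity of the left side of
      \<open>main\<close> and \<open>n \<ge> 1\<close> exclude \<open>J = 0\<close>. For infinite
      \<open>J\<close>, the term in the supremum is \<open>- \<infinity>\<close>.\<close>
    proof (cases J)
      case (real r)
      have le: "exp (real n * ?a) * prob (A n) \<le> r ^ n"
        using main real by (simp add: ennreal_power)
      moreover have gt: "exp (real n * ?a) * prob (A n) > 0" using pos by simp
      ultimately have r: "r > 0" using real n by (cases "r = 0") (auto simp: power_0_left)
      have "real n * ?a + ln (prob (A n)) = ln (exp (real n * ?a) * prob (A n))"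
        using pos by (subst ln_mult) auto
      also have "\<dots> \<le> ln (r ^ n)"
        using le gt by (subst ln_le_cancel_iff) (auto simp: r)
      also have "\<dots> = real n * ln r" using r by (simp add: ln_realpow)
      finally have "real n * (?a - ln r) \<le> - ln (prob (A n))" by (simp add: algebra_simps)
      then have "?a - ln r \<le> - ln (prob (A n)) / real n"
        using n by (subst pos_le_divide_eq) (simp_all add: mult.commute)
      then show ?thesis
        using real r by (simp add: Lambda_plus_def J_def[symmetric] ennreal_log_def)
    next
      case top
      then show ?thesis by (simp add: Lambda_plus_def J_def[symmetric] ennreal_log_def)
    qed
  qed
  have "Lambda_plus_star M (X 0) F U \<mu> \<nu> \<epsilon> u > 0"
  proof -
    \<comment> \<open>Chosen so that \<open>\<beta> * u\<close> is half of
      \<open>\<epsilon>\<close>: the mean \<open>\<mu> - \<beta> * \<nu>\<close> then lies below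
      \<open>?b\<close> by \<open>\<epsilon> / 2\<close>.\<close>
    define \<beta> where "\<beta> = \<epsilon> / (2 * u)"
    have \<beta>: "\<beta> > 0" "\<beta> * u = \<epsilon> / 2" using eps u by (auto simp: \<beta>_def)
    let ?b = "\<mu> + \<epsilon> - \<beta> * (\<nu> + u)"
    \<comment> \<open>Asking only for a real upper bound avoids having to rule out the value
      \<open>- \<infinity>\<close>.\<close>
    obtain c :: real where c: "esssup P (\<lambda>x. ereal (F x - \<beta> * U x)) \<le> ereal c"
      using m_finite[OF \<beta>(1)] by (cases "esssup P (\<lambda>x. ereal (F x - \<beta> * U x))") auto
    have "AE x in distr M borel (X 0). F x - \<beta> * U x \<le> c"
      unfolding law using esssup_AE[of "\<lambda>x. ereal (F x - \<beta> * U x)" P]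
      by eventually_elim (use c order_trans ereal_less_eq(3) in blast)
    then have bdd: "AE \<omega> in M. F (X 0 \<omega>) - \<beta> * U (X 0 \<omega>) \<le> c"
      by (subst (asm) AE_distr_iff) auto
    have int: "integrable M (\<lambda>\<omega>. F (X 0 \<omega>) - \<beta> * U (X 0 \<omega>))"
      using F_finite U_finite by simp
    have "expectation (\<lambda>\<omega>. F (X 0 \<omega>) - \<beta> * U (X 0 \<omega>)) < ?b"
      using F_finite U_finite \<beta> eps by (simp add: mu nu algebra_simps)
    from exponential_moment_less[OF int bdd this] obtain \<theta> where \<theta>: "\<theta> > 0"
      and less: "(\<integral>\<^sup>+\<omega>. ennreal (exp (\<theta> * (F (X 0 \<omega>) - \<beta> * U (X 0 \<omega>)))) \<partial>M) < ennreal (exp (\<theta> * ?b))"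
      by blast
    have "Lambda_plus M (X 0) F U \<theta> (\<theta> * \<beta>) < ereal (\<theta> * ?b)"
      unfolding Lambda_plus_def using less
      by (intro ennreal_log_less) (simp add: right_diff_distrib mult.assoc)
    then have "0 < ereal (\<theta> * (\<mu> + \<epsilon>) - \<theta> * \<beta> * (\<nu> + u)) - Lambda_plus M (X 0) F U \<theta> (\<theta> * \<beta>)"
      by (cases "Lambda_plus M (X 0) F U \<theta> (\<theta> * \<beta>)") (auto simp: right_diff_distrib mult.assoc)
    also have "\<dots> \<le> Lambda_plus_star M (X 0) F U \<mu> \<nu> \<epsilon> u"
      unfolding Lambda_plus_star_def
      by (rule SUP_upper2[of "(\<theta>, \<theta> * \<beta>)"]) (use \<theta> \<beta> in auto)
    finally show ?thesis .
  qed
  with entropy chernoff show ?thesis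
    unfolding A_def[symmetric] by (auto intro!: le_ereal_exp_rate)
qed


end
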